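(* Let $k \geq 3$ be an integer. There exists a unique strictly increasing sequence $\left(A_i^{(k)}\right)_{i=1}^{\infty}$ of positive integers with $A_1^{(k)} = 1$ such that \[ G^{(k)} = \bigcup_{i=1}^{\infty} \left( \frac{1}{A_{2i}^{(k)}}, \frac{1}{A_{2i-1}^{(k)}} \right] \] is a $k$-good set and \[ \operatorname{Bad}\left(G^{(k)}\right) = \bigcup_{i=1}^{\infty} \left( \frac{1}{A_{2i+1}^{(k)}}, \frac{1}{A_{2i}^{(k)}} \right]. \]
   Context: Here $(u,v] = \{x \in \mathbf{R} : u < x \leq v\}$. A geometric progression of length $k$ with integer ratio is a sequence $(a, ar, ar^2, \ldots, ar^{k-1})$ with $a$ a positive real number and $r \geq 2$ an integer. A set of positive real numbers is $k$-good if it contains no geometric progression of length $k$ with integer ratio. For a $k$-good set $G \subseteq (0,1]$, a number $x \in (0,1] \setminus G$ is $k$-bad with respect to $G$ if there exists an integer $r \geq 2$ such that $G \cup \{x\}$ contains $x, xr, xr^2, \ldots, xr^{k-1}$ (equivalently, $xr^j \in G$ for all $j \in \{1, \ldots, k-1\}$). Define $\operatorname{Bad}(G) = \{x \in (0,1] \setminus G : x \text{ is } k\text{-bad with respect to } G\}$. *)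

theory Defs
  imports Complex_Main
begin

definition geom_prog :: "nat \<Rightarrow> real \<Rightarrow> int \<Rightarrow> real set" where
  "geom_prog k a r = (\<lambda>j. a * of_int r ^ j) ` {..<k}"

definition k_good :: "nat \<Rightarrow> real set \<Rightarrow> bool" where
  "k_good k S \<longleftrightarrow>
     S \<subseteq> {0<..} \<and> \<not> (\<exists>a>0. \<exists>r\<ge>2. geom_prog k a r \<subseteq> S)"

definition k_bad :: "nat \<Rightarrow> real set \<Rightarrow> real \<Rightarrow> bool" where
  "k_bad k G x \<longleftrightarrow>
     x \<in> {0<..1} - G \<and> (\<exists>r\<ge>2. geom_prog k x r \<subseteq> insert x G)"

definition Bad :: "nat \<Rightarrow> real set \<Rightarrow> real set" where
  "Bad k G = {x \<in> {0<..1} - G. k_bad k G x}"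

(* Sequences are indexed from 0: A i stands for the (i+1)-st term, so the intervals of the
   first union are (1/A_2, 1/A_1], (1/A_4, 1/A_3], ... in 1-based notation, and those of the
   second are (1/A_3, 1/A_2], (1/A_5, 1/A_4], ...  With 1-based functions on nat, the value
   at the unused index 0 would spoil uniqueness. *)

definition odd_intervals :: "(nat \<Rightarrow> nat) \<Rightarrow> real set" where
  "odd_intervals A = (\<Union>i. {1 / real (A (2 * i + 1)) <.. 1 / real (A (2 * i))})"

definition even_intervals :: "(nat \<Rightarrow> nat) \<Rightarrow> real set" where
  "even_intervals A = (\<Union>i. {1 / real (A (2 * i + 2)) <.. 1 / real (A (2 * i + 1))})"

end

theory Submission
  imports Defs "HOL-Library.Infinite_Set"
begin

text \<open>
  The condition on \<open>A\<close> is a greedy rule for \<open>G = odd_intervals A\<close>: a number of \<open>(0,1]\<close> belongs to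
  \<open>G\<close> exactly if it does not start a progression whose remaining \<open>k - 1\<close> terms lie in \<open>G\<close>. All
  endpoints are reciprocals of integers, so whether \<open>x\<close> lies in \<open>G\<close> depends only on
  \<open>n = \<lfloor>1/x\<rfloor>\<close>. Since \<open>\<lfloor>1/(x r\<^sup>j)\<rfloor>\<close> is the integer quotient of \<open>n\<close> by \<open>r\<^sup>j\<close>, the greedy rule
  itself becomes a rule about integers: for the set \<open>S\<close> of all \<open>n\<close> that occur in \<open>G\<close> and every
  \<open>n \<ge> 1\<close>, \<open>n\<close> belongs to \<open>S\<close> iff there is no \<open>r \<ge> 2\<close> with
  \<open>n div r, \<dots>, n div r\<^sup>k\<^sup>-\<^sup>1\<close> all in \<open>S\<close> (\<open>interval_conditions_iff_greedy\<close>).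

  These quotients are smaller than \<open>n\<close>, so exactly one set \<open>S\<close> of positive integers obeys the rule.
  The numbers \<open>A 0 < A 1 < \<dots>\<close> have to be the places where membership in \<open>S\<close> changes, which shows
  uniqueness. For existence, membership must change infinitely often
  (\<open>infinite_greedy\<close>, \<open>infinite_Compl_greedy\<close>). If \<open>S\<close> contained every integer from \<open>N\<close> on,
  it could not contain \<open>2\<^sup>k N\<close>. If all its members were less than \<open>N\<close>, every \<open>n \<ge> N\<close> would be
  excluded by a ratio \<open>r > n/N\<close>; as \<open>k \<ge> 3\<close>, also \<open>r\<^sup>2 \<le> n\<close>, which is impossible once \<open>n \<ge> N\<^sup>2\<close>.
\<close>

section \<open>Sets of integers made of alternate blocks\<close>

definition block_set :: "(nat \<Rightarrow> nat) \<Rightarrow> nat set" where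
  "block_set A = {n. \<exists>i. A (2 * i) \<le> n \<and> n < A (2 * i + 1)}"

lemma block_index_unique:
  fixes A :: "nat \<Rightarrow> nat"
  assumes "strict_mono A" "A i \<le> n" "n < A (Suc i)" "A j \<le> n" "n < A (Suc j)"
  shows "i = j"
proof -
  have "A i < A (Suc j)" "A j < A (Suc i)" using assms by linarith+
  then show ?thesis using assms(1) by (simp add: strict_mono_less)
qed

lemma block_index_exists:
  fixes A :: "nat \<Rightarrow> nat"
  assumes "strict_mono A" "A 0 \<le> n"
  obtains i where "A i \<le> n" "n < A (Suc i)"
proof -
  have "n < A (Suc n)"
    using strict_mono_imp_increasing[OF assms(1), of "Suc n"] by simp
  define m where "m = (LEAST m. n < A m)"
  have m: "n < A m" unfolding m_def by (rule LeastI) fact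
  with assms(2) obtain i where i: "m = Suc i" by (cases m) auto
  then have "\<not> n < A i" using not_less_Least[of i "\<lambda>m. n < A m"] by (simp add: m_def)
  with m i that[of i] show ?thesis by simp
qed

lemma mem_block_set_iff_even:
  assumes "strict_mono A" "A i \<le> n" "n < A (Suc i)"
  shows "n \<in> block_set A \<longleftrightarrow> even i"
proof
  assume "n \<in> block_set A"
  then obtain j where "A (2 * j) \<le> n" "n < A (Suc (2 * j))"
    by (auto simp: block_set_def)
  then have "i = 2 * j" using block_index_unique assms by blast
  then show "even i" by simp
next
  assume "even i"
  then obtain j where "i = 2 * j" by (auto elim: evenE)
  then show "n \<in> block_set A" using assms by (auto simp: block_set_def)
qed

lemma block_set_lower_bound:
  assumes "strict_mono A" "n \<in> block_set A"
  shows "A 0 \<le> n"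
proof -
  obtain i where "A (2 * i) \<le> n" using assms(2) by (auto simp: block_set_def)
  moreover have "A 0 \<le> A (2 * i)" using assms(1) by (simp add: strict_mono_less_eq)
  ultimately show ?thesis by simp
qed

text \<open>
  If two sequences agree up to \<open>i\<close> and \<open>A\<close> moves on first, then \<open>A (i + 1)\<close> opens a block of the
  other parity for \<open>A\<close> but still belongs to block \<open>i\<close> of \<open>B\<close>.
\<close>

lemma block_set_next_le:
  assumes "strict_mono A" "strict_mono B" "block_set A = block_set B" "A i = B i"
  shows "B (Suc i) \<le> A (Suc i)"
proof (rule ccontr)
  assume "\<not> B (Suc i) \<le> A (Suc i)"
  then have less: "A (Suc i) < B (Suc i)" by simp
  have "B i \<le> A (Suc i)" using assms(1,4) strict_mono_less_eq[of A i "Suc i"] by simp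
  then have "A (Suc i) \<in> block_set B \<longleftrightarrow> even i"
    using mem_block_set_iff_even assms(2) less by blast
  moreover have "A (Suc i) < A (Suc (Suc i))" using assms(1) by (simp add: strict_mono_less)
  then have "A (Suc i) \<in> block_set A \<longleftrightarrow> even (Suc i)"
    using mem_block_set_iff_even[OF assms(1)] by blast
  ultimately show False using assms(3) by simp
qed

lemma block_set_inject:
  assumes "strict_mono A" "strict_mono B" "block_set A = block_set B" "A 0 = B 0"
  shows "A = B"
proof
  show "A i = B i" for i
  proof (induction i)
    case (Suc i)
    then show ?case
      using block_set_next_le[OF assms(1,2,3)] block_set_next_le[OF assms(2,1) assms(3)[symmetric]]
      by (simp add: le_antisym)
  qed (fact assms(4))
qed

text \<open>
  The witness lists the places where membership in \<open>S\<close> changes; infinitude of \<open>S\<close> and of its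
  complement provides the next change at every stage.
\<close>

lemma block_set_exists:
  fixes S :: "nat set"
  assumes "infinite S" "infinite (- S)" "m \<in> S" "\<forall>n\<in>S. m \<le> n"
  obtains A where "strict_mono A" "A 0 = m" "block_set A = S"
proof -
  define nxt where "nxt a = (LEAST n. a < n \<and> (n \<in> S \<longleftrightarrow> a \<notin> S))" for a
  define A where "A = rec_nat m (\<lambda>_. nxt)"
  have A0: "A 0 = m" and A_Suc: "A (Suc i) = nxt (A i)" for i by (simp_all add: A_def)
  have nxt: "a < nxt a \<and> (nxt a \<in> S \<longleftrightarrow> a \<notin> S)" for a
  proof -
    have "\<exists>n. a < n \<and> (n \<in> S \<longleftrightarrow> a \<notin> S)"
      using assms(1,2) by (cases "a \<in> S") (auto simp: infinite_nat_iff_unbounded)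
    then show ?thesis unfolding nxt_def by (rule LeastI_ex)
  qed
  have between: "n \<in> S \<longleftrightarrow> a \<in> S" if "a \<le> n" "n < nxt a" for a n
    using that not_less_Least[of n "\<lambda>n. a < n \<and> (n \<in> S \<longleftrightarrow> a \<notin> S)"]
    by (cases "a = n") (auto simp: nxt_def)
  have mono: "strict_mono A"
    using nxt by (simp add: strict_mono_Suc_iff A_Suc)
  have parity: "A i \<in> S \<longleftrightarrow> even i" for i
    by (induction i) (simp_all add: A0 A_Suc assms(3) nxt)
  have "n \<in> block_set A \<longleftrightarrow> n \<in> S" if "m \<le> n" for n
  proof -
    obtain i where i: "A i \<le> n" "n < A (Suc i)"
      using block_index_exists[OF mono] \<open>m \<le> n\<close> A0 by metis
    then show ?thesis
      using mem_block_set_iff_even[OF mono i] between[of "A i" n] parity by (simp add: A_Suc)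
  qed
  moreover have "m \<le> n" if "n \<in> block_set A" for n
    using block_set_lower_bound[OF mono that] A0 by simp
  ultimately have "block_set A = S" using assms(4) by blast
  then show ?thesis using that mono A0 by blast
qed

section \<open>The greedy set of integers\<close>

text \<open>The integer counterpart of being \<open>k\<close>-bad.\<close>

definition has_ratio :: "nat \<Rightarrow> nat set \<Rightarrow> nat \<Rightarrow> bool" where
  "has_ratio k S n \<longleftrightarrow> (\<exists>r\<ge>2. \<forall>j\<in>{1..<k}. n div r ^ j \<in> S)"

definition greedy :: "nat \<Rightarrow> nat set \<Rightarrow> bool" where
  "greedy k S \<longleftrightarrow> 0 \<notin> S \<and> (\<forall>n\<ge>1. n \<in> S \<longleftrightarrow> \<not> has_ratio k S n)"

lemma div_power_less:
  fixes n r j :: nat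
  assumes "n \<ge> 1" "r \<ge> 2" "j \<ge> 1"
  shows "n div r ^ j < n"
proof -
  have "r ^ j > 1" using assms by (intro one_less_power) auto
  then show ?thesis using assms by simp
qed

lemma has_ratio_cong:
  assumes "n \<ge> 1" "\<And>m. m < n \<Longrightarrow> m \<in> S \<longleftrightarrow> m \<in> T"
  shows "has_ratio k S n \<longleftrightarrow> has_ratio k T n"
proof -
  have "n div r ^ j \<in> S \<longleftrightarrow> n div r ^ j \<in> T" if "r \<ge> 2" "j \<in> {1..<k}" for r j
    using assms(2)[OF div_power_less[OF assms(1)]] that by simp
  then show ?thesis unfolding has_ratio_def by blast
qed

lemma greedy_unique:
  assumes "greedy k S" "greedy k T"
  shows "S = T"
proof -
  have "n \<in> S \<longleftrightarrow> n \<in> T" for n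
  proof (induction n rule: less_induct)
    case (less n)
    show ?case
    proof (cases "n = 0")
      case False
      then have "has_ratio k S n \<longleftrightarrow> has_ratio k T n"
        using less by (intro has_ratio_cong) auto
      with False assms show ?thesis by (simp add: greedy_def)
    qed (use assms in \<open>simp add: greedy_def\<close>)
  qed
  then show ?thesis by blast
qed

text \<open>
  The greedy rule consults \<open>S\<close> only below \<open>n\<close>. Writing the bound \<open>m < n\<close> into the recursion makes it
  well founded; the congruence rule makes the bound available to the termination proof.
\<close>

declare conj_cong [fundef_cong]

function greedy_mem :: "nat \<Rightarrow> nat \<Rightarrow> bool" where
  "greedy_mem k n \<longleftrightarrow> n \<ge> 1 \<and> \<not> has_ratio k {m. m < n \<and> greedy_mem k m} n"
  by auto
termination
  by (relation "measure snd") auto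

declare greedy_mem.simps [simp del]

lemma greedy_mem: "greedy k {n. greedy_mem k n}"
proof -
  have "greedy_mem k n \<longleftrightarrow> \<not> has_ratio k {n. greedy_mem k n} n" if "n \<ge> 1" for n
    using has_ratio_cong[OF that, of "{m. m < n \<and> greedy_mem k m}" "{n. greedy_mem k n}" k] that
    by (subst greedy_mem.simps) simp
  moreover have "\<not> greedy_mem k 0" by (subst greedy_mem.simps) simp
  ultimately show ?thesis by (simp add: greedy_def)
qed

lemma one_mem_greedy:
  assumes "k \<ge> 2" "greedy k S"
  shows "1 \<in> S"
proof -
  \<comment> \<open>All the quotients of 1 are 0.\<close>
  have "\<not> has_ratio k S 1"
    using assms by (auto simp: has_ratio_def greedy_def intro!: bexI[of _ 1])
  then show ?thesis using assms(2) by (simp add: greedy_def)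
qed

text \<open>
  Suppose all members of \<open>S\<close> are less than \<open>N\<close>. A non-member \<open>n \<ge> 1\<close> has a ratio \<open>r\<close> for which
  \<open>n div r\<close> and, as \<open>k \<ge> 3\<close>, also \<open>n div r\<^sup>2\<close> are members. The first is less than \<open>N\<close>, so \<open>n < N r\<close>;
  the second is positive, so \<open>r\<^sup>2 \<le> n\<close>. For \<open>n = N\<^sup>2\<close> these give \<open>N < r\<close> and \<open>r \<le> N\<close>.
\<close>

lemma infinite_greedy:
  assumes "k \<ge> 3" "greedy k S"
  shows "infinite S"
proof
  assume "finite S"
  then obtain N where N: "n < N" if "n \<in> S" for n
    unfolding finite_nat_set_iff_bounded by blast
  have "1 \<in> S" using one_mem_greedy[OF _ assms(2)] assms(1) by linarith
  then have "N \<ge> 1" using N[of 1] by simp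
  then have "N * N \<ge> 1" "N * N \<ge> N" by simp_all
  then have "N * N \<notin> S" using N[of "N * N"] by linarith
  with \<open>N * N \<ge> 1\<close> assms(2) have "has_ratio k S (N * N)" by (simp add: greedy_def)
  then obtain r where "r \<ge> 2" and r: "\<forall>j\<in>{1..<k}. (N * N) div r ^ j \<in> S"
    by (auto simp: has_ratio_def)
  have "(N * N) div r \<in> S" "(N * N) div r ^ 2 \<in> S"
    using bspec[OF r, of 1] bspec[OF r, of 2] assms(1) by simp_all
  moreover have "0 \<notin> S" using assms(2) by (simp add: greedy_def)
  ultimately have "(N * N) div r < N" "(N * N) div r ^ 2 \<noteq> 0"
    by (simp add: N, metis)
  then have "N * N < N * r" "r ^ 2 \<le> N ^ 2"
    using \<open>r \<ge> 2\<close> by (simp_all add: div_less_iff_less_mult div_eq_0_iff power2_eq_square)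
  then show False by (simp add: power2_nat_le_eq_le)
qed

text \<open>
  If \<open>S\<close> contained all integers from \<open>N\<close> on, the ratio 2 would exclude \<open>2\<^sup>k N\<close>, whose first
  \<open>k - 1\<close> halvings are still at least \<open>N\<close>.
\<close>

lemma infinite_Compl_greedy:
  assumes "greedy k S"
  shows "infinite (- S)"
proof
  assume "finite (- S)"
  then obtain N where N: "n < N" if "n \<notin> S" for n
    unfolding finite_nat_set_iff_bounded by blast
  have "0 \<notin> S" using assms by (simp add: greedy_def)
  then have "N \<ge> 1" using N[of 0] by simp
  define n where "n = 2 ^ k * N"
  have "n \<ge> N" "n \<ge> 1" using \<open>N \<ge> 1\<close> by (simp_all add: n_def)
  have "n div 2 ^ j \<in> S" if "j < k" for j
  proof -
    have "n = 2 ^ j * (2 ^ (k - j) * N)"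
      using that by (simp add: n_def flip: power_add mult.assoc)
    then have "n div 2 ^ j = 2 ^ (k - j) * N" by simp
    then have "n div 2 ^ j \<ge> N" by simp
    then show ?thesis using N[of "n div 2 ^ j"] by linarith
  qed
  then have "has_ratio k S n" by (auto simp: has_ratio_def)
  with \<open>n \<ge> 1\<close> assms have "n \<notin> S" by (simp add: greedy_def)
  with N[of n] \<open>n \<ge> N\<close> show False by simp
qed

section \<open>From real intervals to integers\<close>

text \<open>
  Nested floors collapse: \<open>\<lfloor>y / m\<rfloor> = \<lfloor>y\<rfloor> div m\<close> for an integer \<open>m \<ge> 0\<close>. This is why the integer part of
  \<open>1/x\<close> determines that of \<open>1/(x r\<^sup>j)\<close>, and the reason the problem is discrete.
\<close>

lemma nat_floor_inverse_mult_power: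
  fixes x :: real and r :: int
  assumes "r \<ge> 0"
  shows "nat \<lfloor>1 / (x * of_int r ^ j)\<rfloor> = nat \<lfloor>1 / x\<rfloor> div nat r ^ j"
proof -
  have "\<lfloor>1 / x / of_int (r ^ j)\<rfloor> = \<lfloor>1 / x\<rfloor> div r ^ j"
    using assms by (intro floor_divide_real_eq_div) simp
  then show ?thesis using assms by (simp add: nat_div_distrib' nat_power_eq)
qed

lemma mem_reciprocal_interval_iff:
  fixes x :: real and a b :: nat
  assumes "a > 0" "b > 0"
  shows "x \<in> {1 / real b <.. 1 / real a} \<longleftrightarrow> x > 0 \<and> a \<le> nat \<lfloor>1 / x\<rfloor> \<and> nat \<lfloor>1 / x\<rfloor> < b"
proof (cases "x > 0")
  case True
  have "1 / real b < x \<longleftrightarrow> 1 / x < real b" "x \<le> 1 / real a \<longleftrightarrow> real a \<le> 1 / x"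
    using assms True by (auto simp: field_simps)
  moreover have "real a \<le> 1 / x \<longleftrightarrow> a \<le> nat \<lfloor>1 / x\<rfloor>"
    using assms True by (simp add: le_nat_iff le_floor_iff)
  moreover have "1 / x < real b \<longleftrightarrow> nat \<lfloor>1 / x\<rfloor> < b"
    using assms True by (simp add: nat_less_iff floor_less_iff)
  ultimately show ?thesis using True by auto
next
  case False
  have "1 / real b > 0" using assms by simp
  then have "\<not> 1 / real b < x" using False by linarith
  with False show ?thesis by simp
qed

lemma mem_odd_intervals_iff:
  assumes "\<forall>i. A i > 0"
  shows "x \<in> odd_intervals A \<longleftrightarrow> x > 0 \<and> nat \<lfloor>1 / x\<rfloor> \<in> block_set A"
  unfolding odd_intervals_def block_set_def
  using assms by (auto simp: mem_reciprocal_interval_iff simp del: greaterThanAtMost_iff)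

lemma mem_even_intervals_iff:
  assumes "strict_mono A" "\<forall>i. A i > 0"
  shows "x \<in> even_intervals A \<longleftrightarrow> x > 0 \<and> A 0 \<le> nat \<lfloor>1 / x\<rfloor> \<and> nat \<lfloor>1 / x\<rfloor> \<notin> block_set A"
    (is "_ \<longleftrightarrow> _ \<and> A 0 \<le> ?n \<and> _")
proof -
  have "x \<in> even_intervals A \<longleftrightarrow> x > 0 \<and> (\<exists>i. A (2 * i + 1) \<le> ?n \<and> ?n < A (2 * i + 2))"
    unfolding even_intervals_def
    using assms(2) by (auto simp: mem_reciprocal_interval_iff simp del: greaterThanAtMost_iff)
  also have "(\<exists>i. A (2 * i + 1) \<le> ?n \<and> ?n < A (2 * i + 2)) \<longleftrightarrow> A 0 \<le> ?n \<and> ?n \<notin> block_set A"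
    (is "?L \<longleftrightarrow> ?R")
  proof
    assume ?L
    then obtain i where i: "A (Suc (2 * i)) \<le> ?n" "?n < A (Suc (Suc (2 * i)))" by auto
    have "A 0 \<le> A (Suc (2 * i))" using assms(1) by (simp add: strict_mono_less_eq)
    then show ?R using i mem_block_set_iff_even[OF assms(1) i] by auto
  next
    assume ?R
    then obtain i where i: "A i \<le> ?n" "?n < A (Suc i)"
      using block_index_exists[OF assms(1)] by blast
    with \<open>?R\<close> have "odd i" using mem_block_set_iff_even[OF assms(1)] by blast
    then obtain l where "i = 2 * l + 1" by (auto elim: oddE)
    then show ?L using i by auto
  qed
  finally show ?thesis .
qed

text \<open>
  Inserting \<open>x\<close> accounts for the term with \<open>j = 0\<close> only, because \<open>x r\<^sup>j \<noteq> x\<close> for \<open>j \<ge> 1\<close>. For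
  \<open>x\<close> in the set the insertion changes nothing, so the same lemma covers \<open>k\<close>-good and \<open>k\<close>-bad.
\<close>

lemma geom_prog_subset_insert_odd_intervals_iff:
  assumes "\<forall>i. A i > 0" "x > 0" "r \<ge> 2"
  shows "geom_prog k x r \<subseteq> insert x (odd_intervals A) \<longleftrightarrow>
           (\<forall>j\<in>{1..<k}. nat \<lfloor>1 / x\<rfloor> div nat r ^ j \<in> block_set A)"
proof -
  have iff: "x * of_int r ^ j \<in> insert x (odd_intervals A) \<longleftrightarrow>
          j = 0 \<or> nat \<lfloor>1 / x\<rfloor> div nat r ^ j \<in> block_set A" for j
  proof (cases "j = 0")
    case False
    then have "(1::real) < of_int r ^ j" using assms(3) by (intro one_less_power) auto
    then have "x * of_int r ^ j \<noteq> x" using assms(2) by simp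
    then show ?thesis
      using False assms by (simp add: mem_odd_intervals_iff nat_floor_inverse_mult_power)
  qed simp
  have "(\<forall>j\<in>{..<k}. j = 0 \<or> Q j) \<longleftrightarrow> (\<forall>j\<in>{1..<k}. Q j)" for Q
  proof (intro iffI ballI)
    fix j assume "\<forall>j\<in>{..<k}. j = 0 \<or> Q j" "j \<in> {1..<k}"
    then show "Q j" by (auto dest!: bspec[of _ _ j])
  qed auto
  then show ?thesis unfolding geom_prog_def image_subset_iff iff .
qed

lemma ex_ratio_iff_has_ratio:
  assumes "\<forall>i. A i > 0" "x > 0"
  shows "(\<exists>r\<ge>2. geom_prog k x r \<subseteq> insert x (odd_intervals A)) \<longleftrightarrow>
           has_ratio k (block_set A) (nat \<lfloor>1 / x\<rfloor>)" (is "?L \<longleftrightarrow> _")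
proof -
  have "?L \<longleftrightarrow> (\<exists>r\<ge>2::int. \<forall>j\<in>{1..<k}. nat \<lfloor>1 / x\<rfloor> div nat r ^ j \<in> block_set A)"
    using geom_prog_subset_insert_odd_intervals_iff[OF assms] by blast
  also have "\<dots> \<longleftrightarrow> has_ratio k (block_set A) (nat \<lfloor>1 / x\<rfloor>)"
  proof
    assume "\<exists>r\<ge>2::int. \<forall>j\<in>{1..<k}. nat \<lfloor>1 / x\<rfloor> div nat r ^ j \<in> block_set A"
    then obtain r :: int where "r \<ge> 2" "\<forall>j\<in>{1..<k}. nat \<lfloor>1 / x\<rfloor> div nat r ^ j \<in> block_set A"
      by blast
    then show "has_ratio k (block_set A) (nat \<lfloor>1 / x\<rfloor>)"
      unfolding has_ratio_def by (intro exI[of _ "nat r"]) auto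
  next
    assume "has_ratio k (block_set A) (nat \<lfloor>1 / x\<rfloor>)"
    then obtain r where "r \<ge> 2" "\<forall>j\<in>{1..<k}. nat \<lfloor>1 / x\<rfloor> div r ^ j \<in> block_set A"
      by (auto simp: has_ratio_def)
    then show "\<exists>r\<ge>2::int. \<forall>j\<in>{1..<k}. nat \<lfloor>1 / x\<rfloor> div nat r ^ j \<in> block_set A"
      by (intro exI[of _ "int r"]) auto
  qed
  finally show ?thesis .
qed

text \<open>
  Each integer \<open>n \<ge> 1\<close> is represented by the real number \<open>1/n\<close>, so a condition on all
  \<open>\<lfloor>1/x\<rfloor>\<close> is one on all positive integers.
\<close>

lemma all_nat_floor_inverse_iff:
  "(\<forall>x>0::real. 1 \<le> nat \<lfloor>1 / x\<rfloor> \<longrightarrow> P (nat \<lfloor>1 / x\<rfloor>)) \<longleftrightarrow> (\<forall>n\<ge>1. P n)"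
proof
  assume *: "\<forall>x>0::real. 1 \<le> nat \<lfloor>1 / x\<rfloor> \<longrightarrow> P (nat \<lfloor>1 / x\<rfloor>)"
  show "\<forall>n\<ge>1. P n"
  proof (intro allI impI)
    fix n :: nat assume "n \<ge> 1"
    then show "P n" using *[rule_format, of "1 / real n"] by simp
  qed
qed simp

lemma k_good_odd_intervals_iff:
  assumes "k \<ge> 1" "strict_mono A" "\<forall>i. A i > 0"
  shows "k_good k (odd_intervals A) \<longleftrightarrow>
           (\<forall>n\<ge>1. n \<in> block_set A \<longrightarrow> \<not> has_ratio k (block_set A) n)"
proof -
  let ?G = "odd_intervals A"
  have pos: "?G \<subseteq> {0<..}" using assms(3) by (auto simp: mem_odd_intervals_iff)
  have start: "geom_prog k x r \<subseteq> ?G \<longleftrightarrow> x \<in> ?G \<and> geom_prog k x r \<subseteq> insert x ?G" for x r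
  proof -
    have "x \<in> geom_prog k x r" using assms(1) by (auto simp: geom_prog_def intro!: image_eqI[of _ _ 0])
    then show ?thesis by blast
  qed
  have "k_good k ?G \<longleftrightarrow>
          (\<forall>x>0. x \<in> ?G \<longrightarrow> \<not> (\<exists>r\<ge>2. geom_prog k x r \<subseteq> insert x ?G))"
    unfolding k_good_def start using pos by blast
  also have "\<dots> \<longleftrightarrow> (\<forall>x>0::real. 1 \<le> nat \<lfloor>1 / x\<rfloor> \<longrightarrow> nat \<lfloor>1 / x\<rfloor> \<in> block_set A \<longrightarrow>
                        \<not> has_ratio k (block_set A) (nat \<lfloor>1 / x\<rfloor>))"
  proof -
    have "1 \<le> n" if "n \<in> block_set A" for n
      using block_set_lower_bound[OF assms(2) that] assms(3) by (metis One_nat_def Suc_leI le_trans)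
    then show ?thesis
      using ex_ratio_iff_has_ratio[OF assms(3)] mem_odd_intervals_iff[OF assms(3)] by blast
  qed
  also have "\<dots> \<longleftrightarrow> (\<forall>n\<ge>1. n \<in> block_set A \<longrightarrow> \<not> has_ratio k (block_set A) n)"
    by (rule all_nat_floor_inverse_iff)
  finally show ?thesis .
qed

lemma Bad_odd_intervals_iff:
  assumes "strict_mono A" "\<forall>i. A i > 0" "A 0 = 1"
  shows "Bad k (odd_intervals A) = even_intervals A \<longleftrightarrow>
           (\<forall>n\<ge>1. n \<notin> block_set A \<longrightarrow> has_ratio k (block_set A) n)"
proof -
  have unit: "x \<in> {0<..1} \<longleftrightarrow> x > 0 \<and> 1 \<le> nat \<lfloor>1 / x\<rfloor>" for x :: real
    by (auto simp: le_nat_iff le_floor_iff)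
  have mem_Bad: "x \<in> Bad k (odd_intervals A) \<longleftrightarrow> x > 0 \<and> 1 \<le> nat \<lfloor>1 / x\<rfloor> \<and>
          nat \<lfloor>1 / x\<rfloor> \<notin> block_set A \<and> has_ratio k (block_set A) (nat \<lfloor>1 / x\<rfloor>)" for x
    unfolding Bad_def k_bad_def mem_Collect_eq Diff_iff unit mem_odd_intervals_iff[OF assms(2)]
    using ex_ratio_iff_has_ratio[OF assms(2)] by blast
  have "Bad k (odd_intervals A) = even_intervals A \<longleftrightarrow>
          (\<forall>x>0::real. 1 \<le> nat \<lfloor>1 / x\<rfloor> \<longrightarrow>
             (nat \<lfloor>1 / x\<rfloor> \<notin> block_set A \<longrightarrow> has_ratio k (block_set A) (nat \<lfloor>1 / x\<rfloor>)))"
    unfolding set_eq_iff mem_Bad mem_even_intervals_iff[OF assms(1,2)] assms(3) by blast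
  also have "\<dots> \<longleftrightarrow> (\<forall>n\<ge>1. n \<notin> block_set A \<longrightarrow> has_ratio k (block_set A) n)"
    by (rule all_nat_floor_inverse_iff)
  finally show ?thesis .
qed

text \<open>
  Being \<open>k\<close>-good says that no member of the block set has a ratio, and the condition on the bad
  numbers says that every positive non-member has one. Together they are the greedy rule.
\<close>

lemma interval_conditions_iff_greedy:
  assumes "k \<ge> 1" "strict_mono A" "\<forall>i. A i > 0" "A 0 = 1"
  shows "k_good k (odd_intervals A) \<and> Bad k (odd_intervals A) = even_intervals A \<longleftrightarrow>
           greedy k (block_set A)"
proof -
  have "0 \<notin> block_set A" using block_set_lower_bound[OF assms(2), of 0] assms(4) by auto
  then show ?thesis
    unfolding greedy_def k_good_odd_intervals_iff[OF assms(1,2,3)] Bad_odd_intervals_iff[OF assms(2,3,4)]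
    by blast
qed

section \<open>Existence and uniqueness of the sequence\<close>

theorem theorem5:
  fixes k :: nat
  assumes "k \<ge> 3"
  shows "\<exists>!A :: nat \<Rightarrow> nat.
           strict_mono A \<and> (\<forall>i. A i > 0) \<and> A 0 = 1 \<and>
           k_good k (odd_intervals A) \<and>
           Bad k (odd_intervals A) = even_intervals A"
proof -
  define S where "S = {n. greedy_mem k n}"
  have S: "greedy k S" unfolding S_def by (rule greedy_mem)
  have "1 \<in> S" using one_mem_greedy[OF _ S] assms by linarith
  moreover have "\<forall>n\<in>S. 1 \<le> n" using S by (metis greedy_def One_nat_def Suc_leI neq0_conv)
  ultimately obtain A where A: "strict_mono A" "A 0 = 1" "block_set A = S"
    using block_set_exists[OF infinite_greedy[OF assms S] infinite_Compl_greedy[OF S]] by blast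
  have A_pos: "\<forall>i. A i > 0"
  proof
    fix i
    have "A 0 \<le> A i" using A(1) by (simp add: strict_mono_less_eq)
    then show "A i > 0" using A(2) by simp
  qed
  show ?thesis
  proof (rule ex1I[of _ A])
    show "strict_mono A \<and> (\<forall>i. A i > 0) \<and> A 0 = 1 \<and> k_good k (odd_intervals A) \<and>
            Bad k (odd_intervals A) = even_intervals A"
      using interval_conditions_iff_greedy[of k A] A A_pos S assms by simp
  next
    fix B :: "nat \<Rightarrow> nat"
    assume B: "strict_mono B \<and> (\<forall>i. B i > 0) \<and> B 0 = 1 \<and> k_good k (odd_intervals B) \<and>
                 Bad k (odd_intervals B) = even_intervals B"
    then have "greedy k (block_set B)"
      using interval_conditions_iff_greedy[of k B] assms by simp
    then have "block_set B = block_set A" using greedy_unique S A(3) by blast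
    then show "B = A" using block_set_inject A(1,2) B by simp
  qed
qed

end
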